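(* Let $\lambda,\mu$ be real numbers. The double inequality $$\lambda D(a,b)+(1-\lambda)H(a,b)<C(a,b)<\mu D(a,b)+(1-\mu)H(a,b)$$ holds for all $a,b>0$ with $a\neq b$ if and only if $\lambda\leq 2/3$ and $\mu\geq 1$.
   Context: For real $a,b>0$ with $a\neq b$: $H(a,b)=\dfrac{2ab}{a+b}$ is the harmonic mean, $C(a,b)=\dfrac{a^2+b^2}{a+b}$ is the first contraharmonic mean, and $D(a,b)=\dfrac{a^3+b^3}{a^2+b^2}$ is the second contraharmonic mean. *)

theory Defs
  imports Complex_Main
begin

definition harmonic_mean :: "real \<Rightarrow> real \<Rightarrow> real" where
  "harmonic_mean a b = 2 * a * b / (a + b)"

definition contraharmonic_mean1 :: "real \<Rightarrow> real \<Rightarrow> real" where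
  "contraharmonic_mean1 a b = (a ^ 2 + b ^ 2) / (a + b)"

definition contraharmonic_mean2 :: "real \<Rightarrow> real \<Rightarrow> real" where
  "contraharmonic_mean2 a b = (a ^ 3 + b ^ 3) / (a ^ 2 + b ^ 2)"

end

theory Submission
  imports Defs
begin

text \<open>
  Write \<open>H\<close>, \<open>C\<close>, \<open>D\<close> for the three means. Both \<open>C - H\<close> and \<open>D - H\<close> carry the factor
  \<open>(a - b)\<^sup>2 / (a + b)\<close>, and for \<open>a \<noteq> b\<close>,
  \<open>(C - H) / (D - H) = (a\<^sup>2 + b\<^sup>2) / (a\<^sup>2 + a b + b\<^sup>2)\<close>.
  So comparing \<open>C\<close> with \<open>k D + (1 - k) H\<close> amounts to comparing \<open>a\<^sup>2 + b\<^sup>2\<close> with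
  \<open>k (a\<^sup>2 + a b + b\<^sup>2)\<close> (lemma \<open>contraharmonic_mean1_diff_convex_combination\<close> and its two
  corollaries). Since \<open>0 < a b < (a\<^sup>2 + b\<^sup>2) / 2\<close>, the quotient lies strictly between \<open>2/3\<close>
  and \<open>1\<close>. It approaches \<open>2/3\<close> as \<open>a / b\<close> tends to \<open>1\<close> and \<open>1\<close> as \<open>a / b\<close> tends to
  infinity, so neither bound can be improved; explicit points \<open>(a, 1)\<close> witness this.
\<close>

lemma contraharmonic_mean1_diff_convex_combination:
  fixes a b k :: real
  assumes "a > 0" "b > 0"
  shows "contraharmonic_mean1 a b - (k * contraharmonic_mean2 a b + (1 - k) * harmonic_mean a b)
    = (a - b)\<^sup>2 / ((a + b) * (a\<^sup>2 + b\<^sup>2)) * ((a\<^sup>2 + b\<^sup>2) - k * (a\<^sup>2 + a * b + b\<^sup>2))"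
proof -
  have "a + b \<noteq> 0" "a\<^sup>2 + b\<^sup>2 \<noteq> 0"
    using assms by (simp_all add: sum_power2_eq_zero_iff)
  then show ?thesis
    unfolding contraharmonic_mean1_def contraharmonic_mean2_def harmonic_mean_def
    by (simp add: divide_simps) algebra
qed

lemma mean_quotient_factor_pos:
  fixes a b :: real
  assumes "a > 0" "b > 0" "a \<noteq> b"
  shows "(a - b)\<^sup>2 / ((a + b) * (a\<^sup>2 + b\<^sup>2)) > 0"
  using assms by (intro divide_pos_pos mult_pos_pos add_pos_pos) simp_all

lemma convex_combination_less_contraharmonic_mean1_iff:
  fixes a b k :: real
  assumes "a > 0" "b > 0" "a \<noteq> b"
  shows "k * contraharmonic_mean2 a b + (1 - k) * harmonic_mean a b < contraharmonic_mean1 a b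
    \<longleftrightarrow> k * (a\<^sup>2 + a * b + b\<^sup>2) < a\<^sup>2 + b\<^sup>2"
proof -
  let ?f = "(a - b)\<^sup>2 / ((a + b) * (a\<^sup>2 + b\<^sup>2))"
  let ?g = "(a\<^sup>2 + b\<^sup>2) - k * (a\<^sup>2 + a * b + b\<^sup>2)"
  have "0 < ?f * ?g \<longleftrightarrow> 0 < ?g"
    using mean_quotient_factor_pos[OF assms] by (meson zero_less_mult_iff not_less_iff_gr_or_eq)
  then show ?thesis
    using contraharmonic_mean1_diff_convex_combination[OF assms(1,2), of k] by linarith
qed

lemma contraharmonic_mean1_less_convex_combination_iff:
  fixes a b k :: real
  assumes "a > 0" "b > 0" "a \<noteq> b"
  shows "contraharmonic_mean1 a b < k * contraharmonic_mean2 a b + (1 - k) * harmonic_mean a b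
    \<longleftrightarrow> a\<^sup>2 + b\<^sup>2 < k * (a\<^sup>2 + a * b + b\<^sup>2)"
proof -
  let ?f = "(a - b)\<^sup>2 / ((a + b) * (a\<^sup>2 + b\<^sup>2))"
  let ?g = "(a\<^sup>2 + b\<^sup>2) - k * (a\<^sup>2 + a * b + b\<^sup>2)"
  have "?f * ?g < 0 \<longleftrightarrow> ?g < 0"
    using mean_quotient_factor_pos[OF assms] by (meson mult_less_0_iff not_less_iff_gr_or_eq)
  then show ?thesis
    using contraharmonic_mean1_diff_convex_combination[OF assms(1,2), of k] by linarith
qed

theorem theorem3p3:
  fixes l m :: real
  shows "(\<forall>a b :: real. a > 0 \<and> b > 0 \<and> a \<noteq> b \<longrightarrow>
            l * contraharmonic_mean2 a b + (1 - l) * harmonic_mean a b < contraharmonic_mean1 a b \<and>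
            contraharmonic_mean1 a b < m * contraharmonic_mean2 a b + (1 - m) * harmonic_mean a b)
         \<longleftrightarrow> l \<le> 2 / 3 \<and> m \<ge> 1"
  (is "?bounds \<longleftrightarrow> _")
proof
  assume bounds: ?bounds
  have lower: "l * (a\<^sup>2 + a * b + b\<^sup>2) < a\<^sup>2 + b\<^sup>2" if "a > 0" "b > 0" "a \<noteq> b" for a b :: real
    using bounds that convex_combination_less_contraharmonic_mean1_iff by blast
  have upper: "a\<^sup>2 + b\<^sup>2 < m * (a\<^sup>2 + a * b + b\<^sup>2)" if "a > 0" "b > 0" "a \<noteq> b" for a b :: real
    using bounds that contraharmonic_mean1_less_convex_combination_iff by blast
  have "l \<le> 2 / 3"
  proof (rule ccontr)
    assume "\<not> l \<le> 2 / 3"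
    \<comment> \<open>At \<open>(1 + e, 1)\<close> the lower bound reads \<open>(3 l - 2) (1 + e) < (1 - l) e\<^sup>2\<close>, which fails for
      small \<open>e > 0\<close>; as \<open>1 - l < 1/3\<close>, the choice \<open>e = 3 l - 2\<close> is small enough.\<close>
    define e where "e = 3 * l - 2"
    have "e > 0" and l: "l = (e + 2) / 3"
      using \<open>\<not> l \<le> 2 / 3\<close> by (simp_all add: e_def)
    then have "l * ((1 + e)\<^sup>2 + (1 + e) * 1 + 1\<^sup>2) < (1 + e)\<^sup>2 + 1\<^sup>2"
      by (intro lower) simp_all
    moreover have "l * ((1 + e)\<^sup>2 + (1 + e) * 1 + 1\<^sup>2) - ((1 + e)\<^sup>2 + 1\<^sup>2)
        = e + 2 / 3 * e\<^sup>2 + e ^ 3 / 3"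
      unfolding l by (simp add: field_simps power2_eq_square power3_eq_cube)
    moreover have "e + 2 / 3 * e\<^sup>2 + e ^ 3 / 3 > 0"
      using \<open>e > 0\<close> by (intro add_pos_pos) simp_all
    ultimately show False by linarith
  qed
  moreover have "m \<ge> 1"
  proof (rule ccontr)
    assume "\<not> m \<ge> 1"
    \<comment> \<open>With \<open>d = 1 - m\<close>, the upper bound at \<open>(a, 1)\<close> reads \<open>d (a\<^sup>2 + 1) < (1 - d) a\<close>, which fails
      as soon as \<open>d a \<ge> 1 - d\<close>; \<open>a = 1 + 1 / d\<close> satisfies this and differs from \<open>1\<close>.\<close>
    define d where "d = 1 - m"
    define a where "a = 1 + 1 / d"
    have "d > 0" and m: "m = 1 - d"
      using \<open>\<not> m \<ge> 1\<close> by (simp_all add: d_def)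
    have "a > 1" and da: "d * a = d + 1"
      using \<open>d > 0\<close> by (simp_all add: a_def field_simps)
    then have "a\<^sup>2 + 1\<^sup>2 < m * (a\<^sup>2 + a * 1 + 1\<^sup>2)"
      by (intro upper) simp_all
    moreover have "a\<^sup>2 + 1\<^sup>2 - m * (a\<^sup>2 + a * 1 + 1\<^sup>2) = 2 * (d * a) + d"
    proof -
      have "a\<^sup>2 + 1\<^sup>2 - m * (a\<^sup>2 + a * 1 + 1\<^sup>2) = (d * a) * a + d * a - a + d"
        unfolding m by (simp add: algebra_simps power2_eq_square)
      also have "\<dots> = 2 * (d * a) + d"
        unfolding da using da by (simp add: algebra_simps)
      finally show ?thesis .
    qed
    moreover have "2 * (d * a) + d > 0"
      using \<open>d > 0\<close> da by simp
    ultimately show False by linarith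
  qed
  ultimately show "l \<le> 2 / 3 \<and> m \<ge> 1" ..
next
  assume lm: "l \<le> 2 / 3 \<and> m \<ge> 1"
  show ?bounds
  proof (intro allI impI)
    fix a b :: real
    assume "a > 0 \<and> b > 0 \<and> a \<noteq> b"
    then have ab: "a > 0" "b > 0" "a \<noteq> b" by simp_all
    let ?q = "a\<^sup>2 + a * b + b\<^sup>2"
    have "a * b > 0" using ab by simp
    then have "?q > 0" by (simp add: add_nonneg_pos add_pos_nonneg)
    have "(a - b)\<^sup>2 > 0" using ab by simp
    then have q_upper: "2 / 3 * ?q < a\<^sup>2 + b\<^sup>2"
      by (simp add: power2_diff)
    have "l * ?q \<le> 2 / 3 * ?q"
      using lm \<open>?q > 0\<close> by (intro mult_right_mono) simp_all
    then have lower: "l * ?q < a\<^sup>2 + b\<^sup>2"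
      using q_upper by (rule le_less_trans)
    have "a\<^sup>2 + b\<^sup>2 < 1 * ?q"
      using \<open>a * b > 0\<close> by simp
    also have "\<dots> \<le> m * ?q"
      using lm \<open>?q > 0\<close> by (intro mult_right_mono) simp_all
    finally show "l * contraharmonic_mean2 a b + (1 - l) * harmonic_mean a b < contraharmonic_mean1 a b \<and>
        contraharmonic_mean1 a b < m * contraharmonic_mean2 a b + (1 - m) * harmonic_mean a b"
      using convex_combination_less_contraharmonic_mean1_iff[OF ab]
        contraharmonic_mean1_less_convex_combination_iff[OF ab] lower by blast
  qed
qed

end
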